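(* Let $X$ be a simply connected topological space and $A\subset X$ be any subspace. Let $\gamma:S^1\to A$ be a loop (continuous map) and $E\to A$ be a real vector bundle (of finite rank) such that the pullback $\gamma^*E\to S^1$ is not orientable. Then $X\setminus A$ is not empty. *)

theory Defs
  imports "HOL-Analysis.Analysis" "Jordan_Normal_Form.VS_Connect"
begin

text \<open>
  The operations \<open>fadd\<close> and \<open>fscale\<close> of a bundle are only meaningful within a fibre:
  \<open>fadd E v w\<close> is the sum of \<open>v\<close> and \<open>w\<close> when both lie over the same point.
\<close>

record ('b, 'e) bundle_data =
  base :: "'b topology"
  total :: "'e topology"
  proj :: "'e \<Rightarrow> 'b"
  fadd :: "'e \<Rightarrow> 'e \<Rightarrow> 'e"
  fscale :: "real \<Rightarrow> 'e \<Rightarrow> 'e"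

definition over :: "('b, 'e) bundle_data \<Rightarrow> 'b set \<Rightarrow> 'e set" where
  "over E U = {e \<in> topspace (total E). proj E e \<in> U}"

abbreviation fibre :: "('b, 'e) bundle_data \<Rightarrow> 'b \<Rightarrow> 'e set" where
  "fibre E b \<equiv> over E {b}"

text \<open>
  A fibre as a module record; its multiplicative fields play no role in \<open>vectorspace\<close>.
\<close>

definition fibre_module :: "('b, 'e) bundle_data \<Rightarrow> 'b \<Rightarrow> 'e \<Rightarrow> (real, 'e) module" where
  "fibre_module E b z =
     \<lparr>carrier = fibre E b, mult = undefined, one = undefined,
      zero = z, add = fadd E, smult = fscale E\<rparr>"

text \<open>
  A local trivialization is a fibre-preserving homeomorphism from the part of the bundle over
  an open set \<open>U\<close> onto the product of \<open>U\<close> with n-dimensional Euclidean space, linear on each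
  fibre. \<open>Euclidean_space n\<close> consists of the functions on \<open>nat\<close> that vanish from \<open>n\<close> on, so
  that \<open>n = 0\<close> is included.
\<close>

definition local_trivialization ::
  "nat \<Rightarrow> ('b, 'e) bundle_data \<Rightarrow> 'b set \<Rightarrow> ('e \<Rightarrow> 'b \<times> (nat \<Rightarrow> real)) \<Rightarrow> bool" where
  "local_trivialization n E U \<phi> \<longleftrightarrow>
     openin (base E) U \<and>
     homeomorphic_map (subtopology (total E) (over E U))
       (prod_topology (subtopology (base E) U) (Euclidean_space n)) \<phi> \<and>
     (\<forall>e \<in> over E U. fst (\<phi> e) = proj E e) \<and>
     (\<forall>b \<in> U. \<forall>v \<in> fibre E b. \<forall>w \<in> fibre E b.
        snd (\<phi> (fadd E v w)) = (\<lambda>i. snd (\<phi> v) i + snd (\<phi> w) i)) \<and>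
     (\<forall>b \<in> U. \<forall>r. \<forall>v \<in> fibre E b.
        snd (\<phi> (fscale E r v)) = (\<lambda>i. r * snd (\<phi> v) i))"

definition real_vector_bundle :: "nat \<Rightarrow> ('b, 'e) bundle_data \<Rightarrow> bool" where
  "real_vector_bundle n E \<longleftrightarrow>
     continuous_map (total E) (base E) (proj E) \<and>
     (\<forall>b \<in> topspace (base E). \<exists>z. vectorspace class_ring (fibre_module E b z)) \<and>
     (\<forall>b \<in> topspace (base E). \<exists>U \<phi>. b \<in> U \<and> local_trivialization n E U \<phi>)"

definition pullback_bundle ::
  "'s topology \<Rightarrow> ('s \<Rightarrow> 'b) \<Rightarrow> ('b, 'e) bundle_data \<Rightarrow> ('s, 's \<times> 'e) bundle_data" where
  "pullback_bundle S g E =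
     \<lparr>base = S,
      total = subtopology (prod_topology S (total E)) {(s, e). g s = proj E e},
      proj = fst,
      fadd = (\<lambda>v w. (fst v, fadd E (snd v) (snd w))),
      fscale = (\<lambda>r v. (fst v, fscale E r (snd v)))\<rparr>"

text \<open>
  The matrix of the linear automorphism of n-dimensional space given by the change of
  trivialization from \<open>\<phi>\<close> to \<open>\<psi>\<close> in the fibre over \<open>b\<close>: column \<open>j\<close> is the image of the
  \<open>j\<close>-th standard basis vector.
\<close>

definition transition_matrix ::
  "nat \<Rightarrow> ('b, 'e) bundle_data \<Rightarrow> ('e \<Rightarrow> 'b \<times> (nat \<Rightarrow> real)) \<Rightarrow> ('e \<Rightarrow> 'b \<times> (nat \<Rightarrow> real)) \<Rightarrow>
   'b \<Rightarrow> real mat" where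
  "transition_matrix n E \<phi> \<psi> b =
     mat n n (\<lambda>(i, j). snd (\<psi> (inv_into (fibre E b) \<phi> (b, \<lambda>k. if k = j then 1 else 0))) i)"

text \<open>
  Orientability of a bundle of rank \<open>n\<close>: there is a bundle atlas all of whose transition
  functions take values in the matrices of positive determinant. The determinant is the one
  for matrices of varying size; for \<open>n = 0\<close> it equals 1.
\<close>

definition orientable_bundle :: "nat \<Rightarrow> ('b, 'e) bundle_data \<Rightarrow> bool" where
  "orientable_bundle n E \<longleftrightarrow>
     (\<exists>\<A>. (\<forall>(U, \<phi>) \<in> \<A>. local_trivialization n E U \<phi>) \<and>
          (\<Union>(U, \<phi>) \<in> \<A>. U) = topspace (base E) \<and>
          (\<forall>(U, \<phi>) \<in> \<A>. \<forall>(V, \<psi>) \<in> \<A>. \<forall>b \<in> U \<inter> V.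
             0 < Determinant.det (transition_matrix n E \<phi> \<psi> b)))"

end

theory Submission
  imports Defs
begin

text \<open>
  If \<open>A = X\<close>, then \<open>\<gamma>\<close> is null-homotopic in \<open>A\<close> and extends to a map \<open>h\<close> from the whole plane
  to \<open>A\<close>. An orientation along \<open>h\<close> is a choice of a trivialization at every point whose
  orientations agree locally. Two such choices on closed sets with connected intersection can
  be glued, after reversing one of them if they disagree, because the sign of the transition
  determinant is locally constant. Bisecting in both coordinates therefore orients \<open>E\<close> along \<open>h\<close>
  on every rectangle, in particular along the unit circle, and the chosen trivializations pull
  back to an oriented atlas of \<open>\<gamma>\<^sup>*E\<close>.
\<close>


section \<open>Fibres and inverses of local trivializations\<close>

lemma bundle_fibre_closed:
  assumes "real_vector_bundle n E" "b \<in> topspace (base E)" "v \<in> fibre E b"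
  shows "w \<in> fibre E b \<Longrightarrow> fadd E v w \<in> fibre E b"
    and "fscale E r v \<in> fibre E b"
proof -
  obtain z where "vectorspace class_ring (fibre_module E b z)"
    using assms unfolding real_vector_bundle_def by blast
  then interpret V: vectorspace class_ring "fibre_module E b z" .
  have carr: "carrier (fibre_module E b z) = fibre E b"
    "add (fibre_module E b z) = fadd E" "smult (fibre_module E b z) = fscale E"
    by (auto simp: fibre_module_def)
  show "w \<in> fibre E b \<Longrightarrow> fadd E v w \<in> fibre E b"
    using V.M.add.m_closed[of v w] assms carr by auto
  show "fscale E r v \<in> fibre E b"
    using V.smult_closed[of r v] assms carr by (auto simp: class_ring_simps)
qed

lemma local_trivialization_base:
  assumes "local_trivialization n E U \<phi>"
  shows "openin (base E) U" "U \<subseteq> topspace (base E)"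
  using assms openin_subset unfolding local_trivialization_def by blast+

text \<open>Transition matrices use \<open>inv_into\<close> on one fibre at a time, which hides how
  the preimage varies with \<open>b\<close>. Here these fibrewise inverses are identified with a
  single continuous inverse \<open>g\<close> over \<open>U\<close>, from which continuity in the
  base point can be read off.\<close>

lemma local_trivialization_inverse:
  assumes "local_trivialization n E U \<phi>"
  obtains g where
    "homeomorphic_maps (subtopology (total E) (over E U))
       (prod_topology (subtopology (base E) U) (Euclidean_space n)) \<phi> g"
    and "\<And>b v. b \<in> U \<Longrightarrow> v \<in> topspace (Euclidean_space n) \<Longrightarrow>
           inv_into (fibre E b) \<phi> (b, v) = g (b, v)"
proof -
  let ?T = "subtopology (total E) (over E U)"
  let ?P = "prod_topology (subtopology (base E) U) (Euclidean_space n)"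
  obtain g where g: "homeomorphic_maps ?T ?P \<phi> g"
    using assms unfolding local_trivialization_def homeomorphic_map_maps by blast
  have tT: "topspace ?T = over E U" by (auto simp: over_def)
  have tP: "topspace ?P = U \<times> topspace (Euclidean_space n)"
    using local_trivialization_base[OF assms] by auto
  have "inv_into (fibre E b) \<phi> (b, v) = g (b, v)"
    if b: "b \<in> U" and v: "v \<in> topspace (Euclidean_space n)" for b v
  proof -
    have bv: "(b, v) \<in> topspace ?P" using tP b v by auto
    have gU: "g (b, v) \<in> over E U"
      using g bv tT unfolding homeomorphic_maps_def continuous_map_def by blast
    have fg: "\<phi> (g (b, v)) = (b, v)"
      using g bv unfolding homeomorphic_maps_def by blast
    have "proj E (g (b, v)) = b"
      using assms gU fg unfolding local_trivialization_def by (metis fst_conv)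
    then have gb: "g (b, v) \<in> fibre E b" using gU by (auto simp: over_def)
    have "inj_on \<phi> (over E U)"
      using g tT unfolding homeomorphic_maps_def by (metis inj_on_inverseI)
    then have "inj_on \<phi> (fibre E b)"
      by (rule inj_on_subset) (use b in \<open>auto simp: over_def\<close>)
    then show ?thesis using inv_into_f_f[OF _ gb] fg by metis
  qed
  then show ?thesis using that g by blast
qed

abbreviation fibre_inv ::
  "('b, 'e) bundle_data \<Rightarrow> ('e \<Rightarrow> 'b \<times> (nat \<Rightarrow> real)) \<Rightarrow> 'b \<Rightarrow> (nat \<Rightarrow> real) \<Rightarrow> 'e" where
  "fibre_inv E \<phi> b v \<equiv> inv_into (fibre E b) \<phi> (b, v)"

lemma fibre_inv:
  assumes "local_trivialization n E U \<phi>" "b \<in> U"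
  shows "v \<in> topspace (Euclidean_space n) \<Longrightarrow> fibre_inv E \<phi> b v \<in> fibre E b"
    and "v \<in> topspace (Euclidean_space n) \<Longrightarrow> \<phi> (fibre_inv E \<phi> b v) = (b, v)"
    and "e \<in> fibre E b \<Longrightarrow> snd (\<phi> e) \<in> topspace (Euclidean_space n)"
    and "e \<in> fibre E b \<Longrightarrow> fibre_inv E \<phi> b (snd (\<phi> e)) = e"
proof -
  let ?T = "subtopology (total E) (over E U)"
  let ?P = "prod_topology (subtopology (base E) U) (Euclidean_space n)"
  have hom: "homeomorphic_map ?T ?P \<phi>" using assms unfolding local_trivialization_def by blast
  have tT: "topspace ?T = over E U" by (auto simp: over_def)
  have tP: "topspace ?P = U \<times> topspace (Euclidean_space n)"
    using local_trivialization_base[OF assms(1)] by auto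
  have inj: "inj_on \<phi> (over E U)" and im: "\<phi> ` over E U = U \<times> topspace (Euclidean_space n)"
    using hom tT tP homeomorphic_imp_surjective_map homeomorphic_imp_injective_map by metis+
  have fst: "\<And>e. e \<in> over E U \<Longrightarrow> fst (\<phi> e) = proj E e"
    using assms unfolding local_trivialization_def by blast
  have sub: "fibre E b \<subseteq> over E U" using assms(2) by (auto simp: over_def)
  have ex: "(b, v) \<in> \<phi> ` fibre E b" if "v \<in> topspace (Euclidean_space n)" for v
  proof -
    have "(b, v) \<in> \<phi> ` over E U" using im that assms(2) by auto
    then obtain e where e: "e \<in> over E U" "\<phi> e = (b, v)" by (metis imageE)
    then have "e \<in> fibre E b" using fst[OF e(1)] by (auto simp: over_def)
    then show ?thesis using e by (metis imageI)
  qed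
  show "v \<in> topspace (Euclidean_space n) \<Longrightarrow> fibre_inv E \<phi> b v \<in> fibre E b"
    using ex inv_into_into by metis
  show "v \<in> topspace (Euclidean_space n) \<Longrightarrow> \<phi> (fibre_inv E \<phi> b v) = (b, v)"
    using ex f_inv_into_f by metis
  assume e: "e \<in> fibre E b"
  then have fe: "fst (\<phi> e) = b" using fst sub by (auto simp: over_def)
  then have pe: "\<phi> e = (b, snd (\<phi> e))" by (metis prod.collapse)
  show "snd (\<phi> e) \<in> topspace (Euclidean_space n)"
    using im e sub by (metis image_subset_iff mem_Times_iff subset_eq subsetI)
  show "fibre_inv E \<phi> b (snd (\<phi> e)) = e"
    using pe inv_into_f_f[OF inj_on_subset[OF inj sub] e] by metis
qed

section \<open>Transition matrices and their determinants\<close>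

abbreviation std_basis :: "nat \<Rightarrow> nat \<Rightarrow> real" where
  "std_basis j \<equiv> \<lambda>k. if k = j then 1 else 0"

text \<open>Both trivializations are linear on the fibre over \<open>b\<close> and the fibre is
  closed under its operations, so the change of trivialization is linear. It is therefore determined
  by the images of the standard basis, which are the columns of the matrix.\<close>

lemma transition_map_eq_matrix:
  assumes E: "real_vector_bundle n E"
    and \<phi>: "local_trivialization n E U \<phi>" and \<psi>: "local_trivialization n E V \<psi>"
    and b: "b \<in> U" "b \<in> V" and v: "v \<in> topspace (Euclidean_space n)" and i: "i < n"
  shows "snd (\<psi> (fibre_inv E \<phi> b v)) i = (\<Sum>j<n. transition_matrix n E \<phi> \<psi> b $$ (i, j) * v j)"
proof -
  define T where "T v = snd (\<psi> (fibre_inv E \<phi> b v))" for v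
  have bB: "b \<in> topspace (base E)" using local_trivialization_base[OF \<phi>] b by blast
  let ?R = "topspace (Euclidean_space n)"
  have R: "?R = {x. \<forall>i\<ge>n. x i = 0}" by (rule topspace_Euclidean_space)
  have \<phi>_lin: "snd (\<phi> (fadd E v w)) = (\<lambda>i. snd (\<phi> v) i + snd (\<phi> w) i)"
    "snd (\<phi> (fscale E r v)) = (\<lambda>i. r * snd (\<phi> v) i)"
    if "v \<in> fibre E b" "w \<in> fibre E b" for v w r
    using \<phi> that b unfolding local_trivialization_def by blast+
  have \<psi>_lin: "snd (\<psi> (fadd E v w)) = (\<lambda>i. snd (\<psi> v) i + snd (\<psi> w) i)"
    "snd (\<psi> (fscale E r v)) = (\<lambda>i. r * snd (\<psi> v) i)"
    if "v \<in> fibre E b" "w \<in> fibre E b" for v w r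
    using \<psi> that b unfolding local_trivialization_def by blast+
  note inv = fibre_inv[OF \<phi> b(1)]
  have add: "T (\<lambda>i. x i + y i) = (\<lambda>i. T x i + T y i)" if xy: "x \<in> ?R" "y \<in> ?R" for x y
  proof -
    let ?x = "fibre_inv E \<phi> b x" and ?y = "fibre_inv E \<phi> b y"
    have f: "fadd E ?x ?y \<in> fibre E b"
      by (rule bundle_fibre_closed(1)[OF E bB inv(1)[OF xy(1)] inv(1)[OF xy(2)]])
    have "snd (\<phi> (fadd E ?x ?y)) = (\<lambda>i. x i + y i)"
      using \<phi>_lin(1)[OF inv(1)[OF xy(1)] inv(1)[OF xy(2)]] inv(2) xy by simp
    then have "fibre_inv E \<phi> b (\<lambda>i. x i + y i) = fadd E ?x ?y" using inv(4)[OF f] by simp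
    then show ?thesis
      unfolding T_def using \<psi>_lin(1)[OF inv(1)[OF xy(1)] inv(1)[OF xy(2)]] by simp
  qed
  have scale: "T (\<lambda>i. r * x i) = (\<lambda>i. r * T x i)" if x: "x \<in> ?R" for x r
  proof -
    let ?x = "fibre_inv E \<phi> b x"
    have f: "fscale E r ?x \<in> fibre E b"
      by (rule bundle_fibre_closed(2)[OF E bB inv(1)[OF x]])
    have "snd (\<phi> (fscale E r ?x)) = (\<lambda>i. r * x i)"
      using \<phi>_lin(2)[OF inv(1)[OF x] inv(1)[OF x]] inv(2) x by simp
    then have "fibre_inv E \<phi> b (\<lambda>i. r * x i) = fscale E r ?x" using inv(4)[OF f] by simp
    then show ?thesis unfolding T_def using \<psi>_lin(2)[OF inv(1)[OF x] inv(1)[OF x]] by simp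
  qed
  \<comment> \<open>The expansion in the standard basis is proved by induction on the number
    \<open>m\<close> of coordinates of \<open>v\<close> that are kept. The start
    \<open>m = 0\<close> is homogeneity with the scalar 0.\<close>
  have "T (\<lambda>k. if k < m then v k else 0) i = (\<Sum>j<m. v j * T (std_basis j) i)" if "m \<le> n" for m
    using that
  proof (induction m)
    case 0
    have "T (\<lambda>k. 0 * v k) = (\<lambda>k. 0 * T v k)" by (rule scale[OF v])
    then show ?case by simp
  next
    case (Suc m)
    have e: "std_basis m \<in> ?R" using Suc.prems by (auto simp: R)
    have split: "(\<lambda>k. if k < Suc m then v k else 0)
        = (\<lambda>k. (if k < m then v k else 0) + v m * std_basis m k)"
      by (rule ext) (auto simp: less_Suc_eq)
    have "T (\<lambda>k. if k < Suc m then v k else 0) =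
        (\<lambda>k. T (\<lambda>k. if k < m then v k else 0) k + T (\<lambda>k. v m * std_basis m k) k)"
      unfolding split by (rule add) (use Suc.prems in \<open>auto simp: R\<close>)
    then have "T (\<lambda>k. if k < Suc m then v k else 0) i =
        T (\<lambda>k. if k < m then v k else 0) i + v m * T (std_basis m) i"
      using scale[OF e, of "v m"] by simp
    then show ?case using Suc by simp
  qed
  from this[of n] have "T (\<lambda>k. if k < n then v k else 0) i = (\<Sum>j<n. v j * T (std_basis j) i)"
    by simp
  moreover have "(\<lambda>k. if k < n then v k else 0) = v" using v by (auto simp: R)
  moreover have "transition_matrix n E \<phi> \<psi> b $$ (i, j) = T (std_basis j) i" if "j < n" for j
    using that i by (simp add: transition_matrix_def T_def)
  ultimately have "T v i = (\<Sum>j<n. transition_matrix n E \<phi> \<psi> b $$ (i, j) * v j)"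
    by (simp add: mult.commute)
  then show ?thesis by (simp add: T_def)
qed

lemma transition_matrix_carrier [simp]: "transition_matrix n E \<phi> \<psi> b \<in> carrier_mat n n"
  by (simp add: transition_matrix_def)

lemma transition_matrix_self:
  assumes "local_trivialization n E U \<phi>" "b \<in> U"
  shows "transition_matrix n E \<phi> \<phi> b = 1\<^sub>m n"
proof (rule eq_matI)
  fix i j assume "i < dim_row (1\<^sub>m n :: real mat)" "j < dim_col (1\<^sub>m n :: real mat)"
  then have ij: "i < n" "j < n" by auto
  then have "std_basis j \<in> topspace (Euclidean_space n)" by (auto simp: topspace_Euclidean_space)
  from fibre_inv(2)[OF assms this] ij
  show "transition_matrix n E \<phi> \<phi> b $$ (i, j) = 1\<^sub>m n $$ (i, j)"
    by (simp add: transition_matrix_def)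
qed (auto simp: transition_matrix_def)

text \<open>The cocycle identity. Column \<open>j\<close> on the left is the image of the
  \<open>j\<close>-th basis vector; passing through \<psi> on the way makes it the matrix from
  \<psi> to \<theta> applied to column \<open>j\<close> of the matrix from \<phi> to \<psi>.\<close>

lemma transition_matrix_mult:
  assumes E: "real_vector_bundle n E"
    and \<phi>: "local_trivialization n E U \<phi>" and \<psi>: "local_trivialization n E V \<psi>"
    and \<theta>: "local_trivialization n E W \<theta>"
    and b: "b \<in> U" "b \<in> V" "b \<in> W"
  shows "transition_matrix n E \<phi> \<theta> b = transition_matrix n E \<psi> \<theta> b * transition_matrix n E \<phi> \<psi> b"
proof (rule eq_matI)
  fix i j
  assume "i < dim_row (transition_matrix n E \<psi> \<theta> b * transition_matrix n E \<phi> \<psi> b)"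
    "j < dim_col (transition_matrix n E \<psi> \<theta> b * transition_matrix n E \<phi> \<psi> b)"
  then have ij: "i < n" "j < n" by (auto simp: transition_matrix_def)
  let ?e = "fibre_inv E \<phi> b (std_basis j)"
  have "std_basis j \<in> topspace (Euclidean_space n)"
    using ij by (auto simp: topspace_Euclidean_space)
  then have e: "?e \<in> fibre E b" by (rule fibre_inv(1)[OF \<phi> b(1)])
  have "transition_matrix n E \<phi> \<theta> b $$ (i, j) = snd (\<theta> (fibre_inv E \<psi> b (snd (\<psi> ?e)))) i"
    using ij fibre_inv(4)[OF \<psi> b(2) e] by (simp add: transition_matrix_def)
  also have "\<dots> = (\<Sum>k<n. transition_matrix n E \<psi> \<theta> b $$ (i, k) * snd (\<psi> ?e) k)"
    by (rule transition_map_eq_matrix[OF E \<psi> \<theta> b(2,3) fibre_inv(3)[OF \<psi> b(2) e] ij(1)])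
  also have "\<dots> = (\<Sum>k<n. transition_matrix n E \<psi> \<theta> b $$ (i, k) *
      transition_matrix n E \<phi> \<psi> b $$ (k, j))"
    using ij by (intro sum.cong) (auto simp: transition_matrix_def)
  also have "\<dots> = (transition_matrix n E \<psi> \<theta> b * transition_matrix n E \<phi> \<psi> b) $$ (i, j)"
    using ij by (simp add: times_mat_def scalar_prod_def transition_matrix_def lessThan_atLeast0)
  finally show "transition_matrix n E \<phi> \<theta> b $$ (i, j) =
      (transition_matrix n E \<psi> \<theta> b * transition_matrix n E \<phi> \<psi> b) $$ (i, j)" .
qed (auto simp: transition_matrix_def)

abbreviation transition_det where
  "transition_det n E \<phi> \<psi> b \<equiv> Determinant.det (transition_matrix n E \<phi> \<psi> b)"

lemma transition_det_self:
  assumes "local_trivialization n E U \<phi>" "b \<in> U"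
  shows "transition_det n E \<phi> \<phi> b = 1"
  by (simp add: transition_matrix_self[OF assms])

lemma transition_det_mult:
  assumes "real_vector_bundle n E"
    and "local_trivialization n E U \<phi>" and "local_trivialization n E V \<psi>"
    and "local_trivialization n E W \<theta>"
    and "b \<in> U" "b \<in> V" "b \<in> W"
  shows "transition_det n E \<phi> \<theta> b = transition_det n E \<psi> \<theta> b * transition_det n E \<phi> \<psi> b"
  by (simp add: transition_matrix_mult[OF assms] det_mult[of _ n])

lemma transition_det_inverse:
  assumes "real_vector_bundle n E"
    and "local_trivialization n E U \<phi>" and "local_trivialization n E V \<psi>"
    and "b \<in> U" "b \<in> V"
  shows "transition_det n E \<psi> \<phi> b * transition_det n E \<phi> \<psi> b = 1"
  using transition_det_mult[OF assms(1,2,3,2,4,5,4)] transition_det_self[OF assms(2,4)] by simp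

text \<open>Each entry is a composite of continuous maps: \<open>b\<close> goes to
  \<open>(b, std_basis j)\<close>, then through the inverse of \<phi>, then through \<psi>, then to
  coordinate \<open>i\<close>. The determinant is a polynomial in the entries.\<close>

lemma continuous_map_transition_det:
  assumes \<phi>: "local_trivialization n E U \<phi>" and \<psi>: "local_trivialization n E V \<psi>"
  shows "continuous_map (subtopology (base E) (U \<inter> V)) euclideanreal (transition_det n E \<phi> \<psi>)"
proof -
  let ?S = "subtopology (base E) (U \<inter> V)"
  obtain g where g: "homeomorphic_maps (subtopology (total E) (over E U))
       (prod_topology (subtopology (base E) U) (Euclidean_space n)) \<phi> g"
    and ginv: "\<And>b v. b \<in> U \<Longrightarrow> v \<in> topspace (Euclidean_space n) \<Longrightarrow> fibre_inv E \<phi> b v = g (b, v)"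
    using local_trivialization_inverse[OF \<phi>] by blast
  have entry: "continuous_map ?S euclideanreal (\<lambda>b. transition_matrix n E \<phi> \<psi> b $$ (i, j))"
    if ij: "i < n" "j < n" for i j
  proof -
    have e: "std_basis j \<in> topspace (Euclidean_space n)"
      using ij by (auto simp: topspace_Euclidean_space)
    have c1: "continuous_map ?S (prod_topology (subtopology (base E) U) (Euclidean_space n))
        (\<lambda>b. (b, std_basis j))"
      using e by (auto simp: continuous_map_pairwise o_def continuous_map_in_subtopology
          continuous_map_from_subtopology)
    have gc: "continuous_map (prod_topology (subtopology (base E) U) (Euclidean_space n))
        (subtopology (total E) (over E U)) g"
      using g unfolding homeomorphic_maps_def by blast
    have "continuous_map ?S (total E) (\<lambda>b. g (b, std_basis j))"
      using continuous_map_compose[OF c1 continuous_map_into_fulltopology[OF gc]]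
      by (simp add: o_def)
    moreover have "g (b, std_basis j) \<in> over E V" if "b \<in> topspace ?S" for b
      using fibre_inv(1)[OF \<phi> _ e, of b] ginv[OF _ e, of b] that by (auto simp: over_def)
    ultimately have c2: "continuous_map ?S (subtopology (total E) (over E V))
        (\<lambda>b. g (b, std_basis j))"
      by (simp add: continuous_map_in_subtopology)
    have "continuous_map (subtopology (total E) (over E V))
       (prod_topology (subtopology (base E) V) (Euclidean_space n)) \<psi>"
      using \<psi> homeomorphic_imp_continuous_map unfolding local_trivialization_def by blast
    then have "continuous_map (subtopology (total E) (over E V)) (Euclidean_space n) (snd \<circ> \<psi>)"
      by (simp add: continuous_map_pairwise)
    then have "continuous_map (subtopology (total E) (over E V)) (powertop_real UNIV) (snd \<circ> \<psi>)"
      by (simp add: Euclidean_space_def continuous_map_in_subtopology)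
    then have "continuous_map (subtopology (total E) (over E V)) euclideanreal (\<lambda>e. snd (\<psi> e) i)"
      by (simp add: continuous_map_componentwise_UNIV)
    from continuous_map_compose[OF c2 this]
    have "continuous_map ?S euclideanreal (\<lambda>b. snd (\<psi> (g (b, std_basis j))) i)"
      by (simp add: o_def)
    then show ?thesis
      by (rule continuous_map_eq) (use ij ginv e in \<open>auto simp: transition_matrix_def\<close>)
  qed
  \<comment> \<open>The Leibniz formula writes the determinant as a finite sum of products of
    entries.\<close>
  have "continuous_map ?S euclideanreal (\<lambda>b. \<Sum>p\<in>{p. p permutes {0..<n}}.
      signof p * (\<Prod>i = 0..<n. transition_matrix n E \<phi> \<psi> b $$ (i, p i)))"
    by (intro continuous_map_sum continuous_map_real_mult continuous_map_const[THEN iffD2]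
        continuous_map_prod entry) (use permutes_in_image in \<open>fastforce simp: finite_permutations\<close>)+
  then show ?thesis by (simp add: det_def'[OF transition_matrix_carrier])
qed

section \<open>Reversing the orientation of a trivialization\<close>

text \<open>The reflection in coordinate 0. It maps \<open>Euclidean_space n\<close> to itself for
  every \<open>n\<close>; for \<open>n = 0\<close> it fixes the only point, so it reverses
  orientation just when \<open>0 < n\<close>.\<close>

definition flip :: "(nat \<Rightarrow> real) \<Rightarrow> nat \<Rightarrow> real" where
  "flip v = (\<lambda>i. if i = 0 then - v i else v i)"

definition flip_trivialization ::
  "('e \<Rightarrow> 'b \<times> (nat \<Rightarrow> real)) \<Rightarrow> 'e \<Rightarrow> 'b \<times> (nat \<Rightarrow> real)" where
  "flip_trivialization \<phi> e = (fst (\<phi> e), flip (snd (\<phi> e)))"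

lemma flip_flip [simp]: "flip (flip v) = v"
  by (auto simp: flip_def)

lemma continuous_map_flip:
  "continuous_map (Euclidean_space n) (Euclidean_space n) flip"
proof -
  have "continuous_map (Euclidean_space n) euclideanreal (\<lambda>x. x k)" for k
    unfolding Euclidean_space_def
    by (intro continuous_map_from_subtopology continuous_map_product_projection) auto
  then have "continuous_map (Euclidean_space n) euclideanreal (\<lambda>x. flip x k)" for k
    by (cases "k = 0") (auto simp: flip_def intro: continuous_map_minus)
  then have "continuous_map (Euclidean_space n) (powertop_real UNIV) flip"
    by (simp add: continuous_map_componentwise_UNIV)
  then have "continuous_map (Euclidean_space n) (subtopology (powertop_real UNIV) {x. \<forall>i\<ge>n. x i = 0}) flip"
    by (rule continuous_map_into_subtopology) (auto simp: topspace_Euclidean_space flip_def)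
  then show ?thesis by (simp only: Euclidean_space_def[symmetric])
qed

lemma local_trivialization_flip:
  assumes \<phi>: "local_trivialization n E U \<phi>"
  shows "local_trivialization n E U (flip_trivialization \<phi>)"
proof -
  have "homeomorphic_maps (Euclidean_space n) (Euclidean_space n) flip flip"
    by (simp add: homeomorphic_maps_def continuous_map_flip)
  then have "homeomorphic_maps (prod_topology (subtopology (base E) U) (Euclidean_space n))
     (prod_topology (subtopology (base E) U) (Euclidean_space n))
     (\<lambda>(x, y). (x, flip y)) (\<lambda>(x, y). (x, flip y))"
    using homeomorphic_maps_prod[of "subtopology (base E) U" "Euclidean_space n"
        "subtopology (base E) U" "Euclidean_space n" "\<lambda>x. x" flip "\<lambda>x. x" flip]
    by (simp add: homeomorphic_maps_def)
  then have "homeomorphic_map (prod_topology (subtopology (base E) U) (Euclidean_space n))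
     (prod_topology (subtopology (base E) U) (Euclidean_space n)) (\<lambda>(x, y). (x, flip y))"
    using homeomorphic_map_maps by blast
  moreover have "homeomorphic_map (subtopology (total E) (over E U))
      (prod_topology (subtopology (base E) U) (Euclidean_space n)) \<phi>"
    using \<phi> unfolding local_trivialization_def by blast
  ultimately have "homeomorphic_map (subtopology (total E) (over E U))
      (prod_topology (subtopology (base E) U) (Euclidean_space n)) ((\<lambda>(x, y). (x, flip y)) \<circ> \<phi>)"
    using homeomorphic_map_compose by blast
  moreover have "(\<lambda>(x, y). (x, flip y)) \<circ> \<phi> = flip_trivialization \<phi>"
    by (auto simp: flip_trivialization_def split_beta)
  ultimately have "homeomorphic_map (subtopology (total E) (over E U))
      (prod_topology (subtopology (base E) U) (Euclidean_space n)) (flip_trivialization \<phi>)"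
    by simp
  then show ?thesis
    using \<phi> unfolding local_trivialization_def
    by (auto simp: flip_trivialization_def flip_def fun_eq_iff)
qed

text \<open>The matrix is the identity with row 0 negated. In rank 0 there is no such row and the
  determinant is 1, whence the assumption \<open>0 < n\<close>.\<close>

lemma transition_det_flip:
  assumes "local_trivialization n E U \<phi>" "b \<in> U" "0 < n"
  shows "transition_det n E \<phi> (flip_trivialization \<phi>) b = - 1"
proof -
  have "transition_matrix n E \<phi> (flip_trivialization \<phi>) b = multrow 0 (- 1) (1\<^sub>m n)"
  proof (rule eq_matI)
    fix i j assume "i < dim_row (multrow 0 (- 1) (1\<^sub>m n) :: real mat)"
      "j < dim_col (multrow 0 (- 1) (1\<^sub>m n) :: real mat)"
    then have ij: "i < n" "j < n" by auto
    then have "std_basis j \<in> topspace (Euclidean_space n)" by (auto simp: topspace_Euclidean_space)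
    from fibre_inv(2)[OF assms(1,2) this] ij
    show "transition_matrix n E \<phi> (flip_trivialization \<phi>) b $$ (i, j) =
        multrow 0 (- 1) (1\<^sub>m n) $$ (i, j)"
      by (simp add: transition_matrix_def flip_trivialization_def flip_def)
  qed (auto simp: transition_matrix_def)
  then show ?thesis using det_multrow[OF assms(3) one_carrier_mat, of "- 1 :: real"] by simp
qed


section \<open>Signs of transition determinants\<close>

text \<open>Transition determinants are invertible, so not being positive means being negative. The
  equivalence of truth values is then the multiplication rule for signs in the cocycle
  identity.\<close>

lemma transition_det_pos_trans:
  assumes "real_vector_bundle n E"
    and "local_trivialization n E U \<phi>" and "local_trivialization n E V \<psi>"
    and "local_trivialization n E W \<theta>"
    and "b \<in> U" "b \<in> V" "b \<in> W"
  shows "0 < transition_det n E \<phi> \<theta> b \<longleftrightarrow>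
    (0 < transition_det n E \<phi> \<psi> b \<longleftrightarrow> 0 < transition_det n E \<psi> \<theta> b)"
proof -
  have "transition_det n E \<phi> \<psi> b \<noteq> 0" "transition_det n E \<psi> \<theta> b \<noteq> 0"
    using transition_det_inverse[OF assms(1,2,3,5,6)] transition_det_inverse[OF assms(1,3,4,6,7)]
    by auto
  then show ?thesis
    unfolding transition_det_mult[OF assms] by (auto simp: zero_less_mult_iff)
qed

lemma transition_det_pos_sym:
  assumes "real_vector_bundle n E"
    and "local_trivialization n E U \<phi>" and "local_trivialization n E V \<psi>"
    and "b \<in> U" "b \<in> V"
  shows "0 < transition_det n E \<psi> \<phi> b \<longleftrightarrow> 0 < transition_det n E \<phi> \<psi> b"
  using transition_det_pos_trans[OF assms(1,2,3,2,4,5,4)] transition_det_self[OF assms(2,4)] by simp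

text \<open>The determinant is continuous and has no zero on the open set
  \<open>U \<inter> V\<close>, so its sign is locally constant there; pulling back along
  \<open>h\<close> transfers this to the parameter space.\<close>

lemma eventually_transition_det_pos:
  assumes E: "real_vector_bundle n E" and h: "continuous_map euclidean (base E) h"
    and \<phi>: "local_trivialization n E U \<phi>" and \<psi>: "local_trivialization n E V \<psi>"
    and x: "h x \<in> U" "h x \<in> V"
  shows "\<forall>\<^sub>F y in nhds x. h y \<in> U \<and> h y \<in> V \<and>
    (0 < transition_det n E \<phi> \<psi> (h y) \<longleftrightarrow> 0 < transition_det n E \<phi> \<psi> (h x))"
proof -
  define c where "c = transition_det n E \<phi> \<psi> (h x)"
  have c: "c \<noteq> 0"
    using transition_det_inverse[OF E \<phi> \<psi> x] by (auto simp: c_def)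
  let ?S = "subtopology (base E) (U \<inter> V)"
  have UV: "openin (base E) (U \<inter> V)"
    using local_trivialization_base(1) \<phi> \<psi> by blast
  \<comment> \<open>Multiplying by the value \<open>c\<close> at \<open>h x\<close> treats both
    signs at once: the product is positive exactly where the sign is the one at
    \<open>h x\<close>.\<close>
  define W where "W = {b \<in> topspace ?S. c * transition_det n E \<phi> \<psi> b \<in> {0<..}}"
  have "continuous_map ?S euclideanreal (\<lambda>b. c * transition_det n E \<phi> \<psi> b)"
    by (intro continuous_map_real_mult continuous_map_transition_det[OF \<phi> \<psi>]) auto
  from openin_continuous_map_preimage[OF this, of "{0<..}"] have "openin ?S W"
    by (simp add: W_def)
  then have "openin (base E) W" using UV openin_open_subtopology by blast
  then have "open {y \<in> topspace euclidean. h y \<in> W}"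
    using openin_continuous_map_preimage[OF h] by (metis open_openin)
  moreover have "x \<in> {y \<in> topspace euclidean. h y \<in> W}"
    using x c local_trivialization_base(2)[OF \<phi>] by (auto simp: W_def c_def zero_less_mult_iff)
  ultimately have "\<forall>\<^sub>F y in nhds x. y \<in> {y \<in> topspace euclidean. h y \<in> W}"
    by (rule eventually_nhds_in_open)
  then show ?thesis
    by (rule eventually_mono) (auto simp: W_def c_def zero_less_mult_iff)
qed

section \<open>Orientations of a bundle along a map\<close>

text \<open>This amounts to an orientation of the pullback of \<open>E\<close> along
  \<open>h\<close> over \<open>S\<close>, expressed on \<open>E\<close> itself. The choice \<sigma>
  need not vary continuously: only the orientation it induces at each point matters, and for
  \<open>y\<close> in \<open>S\<close> near \<open>x\<close> the trivializations at \<open>x\<close>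
  and \<open>y\<close> are compared in the fibre over \<open>h y\<close>.\<close>

definition orients_along ::
  "nat \<Rightarrow> ('b, 'e) bundle_data \<Rightarrow> ('k::topological_space \<Rightarrow> 'b) \<Rightarrow> 'k set \<Rightarrow>
   ('k \<Rightarrow> 'b set \<times> ('e \<Rightarrow> 'b \<times> (nat \<Rightarrow> real))) \<Rightarrow> bool" where
  "orients_along n E h S \<sigma> \<longleftrightarrow>
     (\<forall>x\<in>S. local_trivialization n E (fst (\<sigma> x)) (snd (\<sigma> x)) \<and> h x \<in> fst (\<sigma> x)) \<and>
     (\<forall>x\<in>S. \<forall>\<^sub>F y in nhds x. y \<in> S \<longrightarrow> h y \<in> fst (\<sigma> x) \<and>
        0 < transition_det n E (snd (\<sigma> x)) (snd (\<sigma> y)) (h y))"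

lemma orients_alongD:
  assumes "orients_along n E h S \<sigma>" "x \<in> S"
  shows "local_trivialization n E (fst (\<sigma> x)) (snd (\<sigma> x))" "h x \<in> fst (\<sigma> x)"
    and "\<forall>\<^sub>F y in nhds x. y \<in> S \<longrightarrow> h y \<in> fst (\<sigma> x) \<and>
        0 < transition_det n E (snd (\<sigma> x)) (snd (\<sigma> y)) (h y)"
  using assms unfolding orients_along_def by auto

lemma orients_along_subset:
  assumes "orients_along n E h S \<sigma>" "T \<subseteq> S"
  shows "orients_along n E h T \<sigma>"
  using assms unfolding orients_along_def by (fastforce elim: eventually_mono)

text \<open>One trivialization around \<open>h x\<close> serves as a constant choice on the preimage
  of its domain, where all determinants in question are 1.\<close>

lemma orients_along_locally:
  assumes E: "real_vector_bundle n E" and h: "continuous_map euclidean (base E) h"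
  obtains N where "open N" "x \<in> N" "\<And>S. S \<subseteq> N \<Longrightarrow> \<exists>\<sigma>. orients_along n E h S \<sigma>"
proof -
  have "h x \<in> topspace (base E)" using h by (auto simp: continuous_map_def)
  then obtain U \<phi> where U: "h x \<in> U" and \<phi>: "local_trivialization n E U \<phi>"
    using E unfolding real_vector_bundle_def by blast
  show ?thesis
  proof
    show "open {y \<in> topspace euclidean. h y \<in> U}"
      using openin_continuous_map_preimage[OF h local_trivialization_base(1)[OF \<phi>]]
      by (metis open_openin)
    show "x \<in> {y \<in> topspace euclidean. h y \<in> U}" using U by simp
    fix S assume S: "S \<subseteq> {y \<in> topspace euclidean. h y \<in> U}"
    have "0 < transition_det n E \<phi> \<phi> (h y)" if "y \<in> S" for y
      using transition_det_self[OF \<phi>, of "h y"] S that by auto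
    then have "orients_along n E h S (\<lambda>_. (U, \<phi>))"
      unfolding orients_along_def using \<phi> S by (auto intro!: always_eventually)
    then show "\<exists>\<sigma>. orients_along n E h S \<sigma>" by blast
  qed
qed

text \<open>Two reversals cancel. The change from the trivialization at \<open>x\<close> to the
  reversed one at \<open>y\<close> is factored in two ways, through the reversed one at
  \<open>x\<close> and through the unreversed one at \<open>y\<close>; each factorization contains
  exactly one determinant -1, so the remaining two have equal sign.\<close>

lemma orients_along_flip:
  assumes E: "real_vector_bundle n E" and \<sigma>: "orients_along n E h S \<sigma>" and n: "0 < n"
  shows "orients_along n E h S (\<lambda>x. (fst (\<sigma> x), flip_trivialization (snd (\<sigma> x))))"
  unfolding orients_along_def
proof (intro conjI ballI; simp)
  fix x assume x: "x \<in> S"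
  note \<sigma>x = orients_alongD[OF \<sigma> x]
  show "local_trivialization n E (fst (\<sigma> x)) (flip_trivialization (snd (\<sigma> x)))"
    by (rule local_trivialization_flip[OF \<sigma>x(1)])
  show "h x \<in> fst (\<sigma> x)" by (rule \<sigma>x(2))
  show "\<forall>\<^sub>F y in nhds x. y \<in> S \<longrightarrow> h y \<in> fst (\<sigma> x) \<and> 0 < transition_det n E
      (flip_trivialization (snd (\<sigma> x))) (flip_trivialization (snd (\<sigma> y))) (h y)"
    using \<sigma>x(3)
  proof (rule eventually_mono, intro impI)
    fix y assume y: "y \<in> S" and "y \<in> S \<longrightarrow> h y \<in> fst (\<sigma> x) \<and>
        0 < transition_det n E (snd (\<sigma> x)) (snd (\<sigma> y)) (h y)"
    then have hy: "h y \<in> fst (\<sigma> x)"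
      and pos: "0 < transition_det n E (snd (\<sigma> x)) (snd (\<sigma> y)) (h y)" by auto
    note \<sigma>y = orients_alongD[OF \<sigma> y]
    note fx = local_trivialization_flip[OF \<sigma>x(1)] and fy = local_trivialization_flip[OF \<sigma>y(1)]
    show "h y \<in> fst (\<sigma> x) \<and> 0 < transition_det n E
      (flip_trivialization (snd (\<sigma> x))) (flip_trivialization (snd (\<sigma> y))) (h y)"
      using hy pos transition_det_flip[OF \<sigma>x(1) hy n] transition_det_flip[OF \<sigma>y(1,2) n]
        transition_det_pos_trans[OF E \<sigma>x(1) fx fy hy hy \<sigma>y(2)]
        transition_det_pos_trans[OF E \<sigma>x(1) \<sigma>y(1) fy hy \<sigma>y(2,2)]
      by simp
  qed
qed

section \<open>Gluing orientations on closed sets\<close>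

text \<open>At a point of only one of the sets, closedness of the other keeps nearby points out of
  it, so nothing new has to be compared. At a common point both local conditions hold, and the
  agreement at that point persists nearby because signs are locally constant.\<close>

lemma orients_along_Un_agree:
  assumes E: "real_vector_bundle n E" and h: "continuous_map euclidean (base E) h"
    and \<sigma>: "orients_along n E h S \<sigma>" and \<tau>: "orients_along n E h T \<tau>"
    and "closed S" "closed T"
    and agree: "\<And>x. x \<in> S \<inter> T \<Longrightarrow> 0 < transition_det n E (snd (\<sigma> x)) (snd (\<tau> x)) (h x)"
  shows "orients_along n E h (S \<union> T) (\<lambda>x. if x \<in> S then \<sigma> x else \<tau> x)"
    (is "orients_along n E h _ ?\<rho>")
proof -
  have "\<forall>\<^sub>F y in nhds x. y \<in> S \<union> T \<longrightarrow> h y \<in> fst (?\<rho> x) \<and>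
      0 < transition_det n E (snd (?\<rho> x)) (snd (?\<rho> y)) (h y)" if x: "x \<in> S \<union> T" for x
  proof -
    consider "x \<in> S" "x \<in> T" | "x \<in> S" "x \<notin> T" | "x \<notin> S" "x \<in> T" using x by blast
    then show ?thesis
    proof cases
      case 1
      note \<sigma>x = orients_alongD[OF \<sigma> 1(1)] and \<tau>x = orients_alongD[OF \<tau> 1(2)]
      show ?thesis
        using \<sigma>x(3) \<tau>x(3) eventually_transition_det_pos[OF E h \<sigma>x(1) \<tau>x(1) \<sigma>x(2) \<tau>x(2)]
      proof (rule eventually_elim2[OF _ eventually_conj], goal_cases)
        case (1 y)
        show ?case
        proof (cases "y \<in> S")
          \<comment> \<open>Here \<open>x\<close> is oriented by \<sigma> and \<open>y\<close> by
            \<tau>. The comparison passes through the trivialization \<open>\<tau> x\<close>: the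
            change from \<open>\<sigma> x\<close> to it is positive at \<open>h x\<close> by
            agreement, hence also at \<open>h y\<close>.\<close>
          case False
          show ?thesis
          proof
            assume "y \<in> S \<union> T"
            then have y: "y \<in> T" using False by simp
            note \<tau>y = orients_alongD[OF \<tau> y]
            show "h y \<in> fst (?\<rho> x) \<and> 0 < transition_det n E (snd (?\<rho> x)) (snd (?\<rho> y)) (h y)"
              using 1 y False \<open>x \<in> S\<close> \<open>x \<in> T\<close> agree[of x] \<tau>y
                transition_det_pos_trans[OF E \<sigma>x(1) \<tau>x(1) \<tau>y(1), of "h y"]
              by simp
          qed
        qed (use 1 \<open>x \<in> S\<close> in simp)
      qed
    next
      case 2
      have "\<forall>\<^sub>F y in nhds x. y \<in> - T"
        using 2 \<open>closed T\<close> by (intro eventually_nhds_in_open) auto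
      then show ?thesis
        using orients_alongD(3)[OF \<sigma> 2(1)] by eventually_elim (use 2 in auto)
    next
      case 3
      have "\<forall>\<^sub>F y in nhds x. y \<in> - S"
        using 3 \<open>closed S\<close> by (intro eventually_nhds_in_open) auto
      then show ?thesis
        using orients_alongD(3)[OF \<tau> 3(2)] by eventually_elim (use 3 in auto)
    qed
  qed
  moreover have "local_trivialization n E (fst (?\<rho> x)) (snd (?\<rho> x)) \<and> h x \<in> fst (?\<rho> x)"
    if "x \<in> S \<union> T" for x
    using that orients_alongD(1,2)[OF \<sigma>] orients_alongD(1,2)[OF \<tau>] by auto
  ultimately show ?thesis unfolding orients_along_def by blast
qed

text \<open>Whether the two orientations agree is locally constant on the connected intersection,
  hence constant. If they disagree throughout, reversing \<tau> makes them agree; an empty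
  intersection falls under agreement.\<close>

lemma orients_along_Un:
  assumes E: "real_vector_bundle n E" and h: "continuous_map euclidean (base E) h"
    and \<sigma>: "orients_along n E h S \<sigma>" and \<tau>: "orients_along n E h T \<tau>"
    and closed: "closed S" "closed T" and conn: "connected (S \<inter> T)"
  shows "\<exists>\<rho>. orients_along n E h (S \<union> T) \<rho>"
proof -
  define f where "f x \<longleftrightarrow> 0 < transition_det n E (snd (\<sigma> x)) (snd (\<tau> x)) (h x)" for x
  \<comment> \<open>For \<open>y\<close> near \<open>x\<close>, the change from
    \<open>\<sigma> x\<close> to \<open>\<tau> y\<close> is factored through \<open>\<tau> x\<close>
    and through \<open>\<sigma> y\<close>. Since \<sigma> and \<tau> are each locally coherent, this
    equates the sign between \<open>\<sigma> y\<close> and \<open>\<tau> y\<close> with the one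
    between \<open>\<sigma> x\<close> and \<open>\<tau> x\<close> at \<open>h y\<close>, which is
    the one at \<open>h x\<close>.\<close>
  have "\<forall>\<^sub>F y in at x within S \<inter> T. f x = f y" if x: "x \<in> S \<inter> T" for x
  proof -
    note \<sigma>x = orients_alongD[OF \<sigma> IntD1[OF x]] and \<tau>x = orients_alongD[OF \<tau> IntD2[OF x]]
    show ?thesis
      unfolding eventually_at_filter
      using \<sigma>x(3) \<tau>x(3) eventually_transition_det_pos[OF E h \<sigma>x(1) \<tau>x(1) \<sigma>x(2) \<tau>x(2)]
    proof (rule eventually_elim2[OF _ eventually_conj], goal_cases)
      case (1 y)
      show ?case
      proof (intro impI)
        assume y: "y \<in> S \<inter> T"
        note \<sigma>y = orients_alongD[OF \<sigma> IntD1[OF y]] and \<tau>y = orients_alongD[OF \<tau> IntD2[OF y]]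
        show "f x = f y"
          unfolding f_def
          using 1 y \<sigma>y \<tau>y transition_det_pos_trans[OF E \<sigma>x(1) \<tau>x(1) \<tau>y(1), of "h y"]
            transition_det_pos_trans[OF E \<sigma>x(1) \<sigma>y(1) \<tau>y(1), of "h y"]
          by auto
      qed
    qed
  qed
  then have const: "f x = f y" if "x \<in> S \<inter> T" "y \<in> S \<inter> T" for x y
    using connected_local_const[OF conn that] by blast
  show ?thesis
  proof (cases "\<forall>x\<in>S \<inter> T. f x")
    case True
    then show ?thesis
      using orients_along_Un_agree[OF E h \<sigma> \<tau> closed] by (auto simp: f_def)
  next
    case False
    then have nf: "\<not> f x" if "x \<in> S \<inter> T" for x using const that by blast
    \<comment> \<open>In rank 0 every transition determinant is the empty determinant 1, so
      disagreement forces positive rank and the reversal has determinant -1.\<close>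
    have "0 < n"
    proof (rule ccontr)
      assume "\<not> 0 < n"
      then have "f x" for x
        by (simp add: f_def det_def'[OF transition_matrix_carrier])
      then show False using False by blast
    qed
    let ?\<tau> = "\<lambda>x. (fst (\<tau> x), flip_trivialization (snd (\<tau> x)))"
    have "0 < transition_det n E (snd (\<sigma> x)) (snd (?\<tau> x)) (h x)" if x: "x \<in> S \<inter> T" for x
    proof -
      note \<sigma>x = orients_alongD[OF \<sigma> IntD1[OF x]] and \<tau>x = orients_alongD[OF \<tau> IntD2[OF x]]
      show ?thesis
        using nf[OF x] transition_det_flip[OF \<tau>x(1,2) \<open>0 < n\<close>]
          transition_det_pos_trans[OF E \<sigma>x(1) \<tau>x(1) local_trivialization_flip[OF \<tau>x(1)]
            \<sigma>x(2) \<tau>x(2,2)]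
        by (simp add: f_def)
    qed
    then show ?thesis
      using orients_along_Un_agree[OF E h \<sigma> orients_along_flip[OF E \<tau> \<open>0 < n\<close>] closed] by blast
  qed
qed

section \<open>Orientations along maps on rectangles\<close>

text \<open>Two nested uses of bisection in the form of the rule \<open>Bolzano\<close>: the inner
  one, in the vertical coordinate, orients thin strips of full height around a given abscissa; the
  outer one, in the horizontal coordinate, joins these strips.\<close>

lemma orients_along_cbox:
  fixes h :: "complex \<Rightarrow> 'b"
  assumes E: "real_vector_bundle n E" and h: "continuous_map euclidean (base E) h"
    and "a \<le> b" "c \<le> d"
  shows "\<exists>\<sigma>. orients_along n E h (cbox (Complex a c) (Complex b d)) \<sigma>"
proof -
  define Q where "Q S \<longleftrightarrow> (\<exists>\<sigma>. orients_along n E h S \<sigma>)" for S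
  let ?R = "\<lambda>a b c d. cbox (Complex a c) (Complex b d)"
  \<comment> \<open>Two rectangles meet in a convex, hence connected, set, so the gluing lemma
    applies.\<close>
  have Un: "Q (?R a b c d \<union> ?R a' b' c' d')"
    if "Q (?R a b c d)" "Q (?R a' b' c' d')" for a b c d a' b' c' d'
    using that orients_along_Un[OF E h _ _ closed_cbox closed_cbox
        convex_connected[OF convex_Int[OF convex_box(1) convex_box(1)]]]
    unfolding Q_def by blast
  \<comment> \<open>This is exactly the local hypothesis of the outer bisection. The width bound is
    quantified inside the property being bisected, so that joining two pieces of the strip can take
    the smaller of their bounds.\<close>
  have strip: "\<exists>\<delta>>0. \<forall>a b. a \<le> x \<and> x \<le> b \<and> b - a < \<delta> \<longrightarrow> Q (?R a b c d)" for x
    using \<open>c \<le> d\<close>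
  proof (induction c d rule: Bolzano)
    case (trans c d e)
    from trans(1) obtain \<delta>1 where \<delta>1: "\<delta>1 > 0"
      "\<And>a b. a \<le> x \<and> x \<le> b \<and> b - a < \<delta>1 \<Longrightarrow> Q (?R a b c d)" by blast
    from trans(2) obtain \<delta>2 where \<delta>2: "\<delta>2 > 0"
      "\<And>a b. a \<le> x \<and> x \<le> b \<and> b - a < \<delta>2 \<Longrightarrow> Q (?R a b d e)" by blast
    have "?R a b c e = ?R a b c d \<union> ?R a b d e" for a b
      using trans(3,4) by (auto simp: in_cbox_complex_iff)
    then show ?case
      using \<delta>1 \<delta>2 Un by (intro exI[of _ "min \<delta>1 \<delta>2"]) auto
  next
    case (local y)
    obtain N where N: "open N" "Complex x y \<in> N" "\<And>S. S \<subseteq> N \<Longrightarrow> Q S"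
      using orients_along_locally[OF E h, of "Complex x y"] unfolding Q_def by blast
    then obtain e where e: "e > 0" "ball (Complex x y) e \<subseteq> N"
      using open_contains_ball by blast
    \<comment> \<open>The bound \<open>e / 2\<close> on both sides of the rectangle keeps each
      coordinate within \<open>e / 2\<close> of the centre, and the modulus is at most the sum of
      the two deviations.\<close>
    have "?R a b c d \<subseteq> ball (Complex x y) e"
      if "a \<le> x" "x \<le> b" "b - a < e / 2" "c \<le> y" "y \<le> d" "d - c < e / 2" for a b c d
    proof
      fix z assume "z \<in> ?R a b c d"
      then have "\<bar>Re (z - Complex x y)\<bar> + \<bar>Im (z - Complex x y)\<bar> < e"
        using that by (auto simp: in_cbox_complex_iff)
      then show "z \<in> ball (Complex x y) e"
        using cmod_le[of "z - Complex x y"] by (simp add: dist_norm norm_minus_commute)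
    qed
    then have "Q (?R a b c d)"
      if "a \<le> x" "x \<le> b" "b - a < e / 2" "c \<le> y" "y \<le> d" "d - c < e / 2" for a b c d
      using that e(2) N(3) by (meson subset_trans)
    then show ?case using e(1) by (intro exI[of _ "e / 2"] conjI allI impI) auto
  qed
  have "Q (?R a b c d)"
    using \<open>a \<le> b\<close>
  proof (induction a b rule: Bolzano)
    case (trans a a' b)
    have "?R a b c d = ?R a a' c d \<union> ?R a' b c d"
      using trans(3,4) by (auto simp: in_cbox_complex_iff)
    then show ?case using Un trans(1,2) by metis
  qed (use strip in blast)
  then show ?thesis by (simp add: Q_def)
qed

section \<open>Trivializations and orientability of the pullback bundle\<close>

text \<open>If \<open>k\<close> inverts \<phi>, the inverse of the pulled-back trivialization sends
  \<open>(s, v)\<close> to \<open>(s, k (g s, v))\<close>. The domain \<open>N\<close> may be any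
  open set mapped into \<open>U\<close>, which later allows shrinking it to where orientations
  agree.\<close>

lemma local_trivialization_pullback:
  assumes \<phi>: "local_trivialization n E U \<phi>" and g: "continuous_map T (base E) g"
    and N: "openin T N" and gN: "g ` N \<subseteq> U"
  shows "local_trivialization n (pullback_bundle T g E) N (\<lambda>(s, e). (s, snd (\<phi> e)))"
proof -
  let ?P = "pullback_bundle T g E"
  let ?Y = "subtopology (total ?P) (over ?P N)"
  let ?Z = "prod_topology (subtopology T N) (Euclidean_space n)"
  have NT: "N \<subseteq> topspace T" using N by (rule openin_subset)
  have overN: "over ?P N = {(s, e). s \<in> N \<and> e \<in> topspace (total E) \<and> proj E e = g s}"
    using NT by (auto simp: over_def pullback_bundle_def)
  then have tY: "topspace ?Y = over ?P N" by (auto simp: over_def)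
  obtain k where k: "homeomorphic_maps (subtopology (total E) (over E U))
       (prod_topology (subtopology (base E) U) (Euclidean_space n)) \<phi> k"
    using \<phi> unfolding local_trivialization_def homeomorphic_map_maps by blast
  have tU: "topspace (subtopology (total E) (over E U)) = over E U" by (auto simp: over_def)
  have tB: "topspace (prod_topology (subtopology (base E) U) (Euclidean_space n)) =
      U \<times> topspace (Euclidean_space n)"
    using local_trivialization_base[OF \<phi>] by auto
  have fst\<phi>: "fst (\<phi> e) = proj E e" if "e \<in> over E U" for e
    using \<phi> that unfolding local_trivialization_def by blast
  have k\<phi>: "k (\<phi> e) = e" if "e \<in> over E U" for e
    using k that tU unfolding homeomorphic_maps_def by blast
  have \<phi>k: "\<phi> (k (b, v)) = (b, v)" "k (b, v) \<in> over E U"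
    if "b \<in> U" "v \<in> topspace (Euclidean_space n)" for b v
    using k that tB tU unfolding homeomorphic_maps_def continuous_map_def by blast+
  have cY: "continuous_map ?Y T fst" "continuous_map ?Y (total E) snd"
    by (auto simp: pullback_bundle_def continuous_map_from_subtopology continuous_map_fst continuous_map_snd)
  have sndU: "snd y \<in> over E U" if "y \<in> over ?P N" for y
    using that gN unfolding overN by (auto simp: over_def)
  have cYU: "continuous_map ?Y (subtopology (total E) (over E U)) snd"
    by (rule continuous_map_into_subtopology[OF cY(2)]) (use tY sndU in blast)
  have "continuous_map (subtopology (total E) (over E U)) (Euclidean_space n) (snd \<circ> \<phi>)"
    using k by (simp add: homeomorphic_maps_def continuous_map_pairwise)
  from continuous_map_compose[OF cYU this]
  have "continuous_map ?Y (Euclidean_space n) (\<lambda>y. snd (\<phi> (snd y)))" by (simp add: o_def)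
  moreover have "continuous_map ?Y (subtopology T N) fst"
    by (rule continuous_map_into_subtopology[OF cY(1)]) (use tY overN in auto)
  ultimately have c1: "continuous_map ?Y ?Z (\<lambda>(s, e). (s, snd (\<phi> e)))"
    by (simp add: continuous_map_pairwise o_def split_beta)
  have cZ: "continuous_map ?Z T fst"
    using continuous_map_fst continuous_map_into_fulltopology by blast
  have "continuous_map ?Z (base E) (\<lambda>y. g (fst y))"
    using continuous_map_compose[OF cZ g] by (simp add: o_def)
  then have "continuous_map ?Z (subtopology (base E) U) (\<lambda>y. g (fst y))"
    by (rule continuous_map_into_subtopology) (use gN in auto)
  then have "continuous_map ?Z (prod_topology (subtopology (base E) U) (Euclidean_space n))
      (\<lambda>y. (g (fst y), snd y))"
    by (simp add: continuous_map_pairwise o_def continuous_map_snd)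
  moreover have "continuous_map (prod_topology (subtopology (base E) U) (Euclidean_space n)) (total E) k"
    using k continuous_map_into_fulltopology unfolding homeomorphic_maps_def by blast
  ultimately have ck: "continuous_map ?Z (total E) (\<lambda>y. k (g (fst y), snd y))"
    using continuous_map_compose by (fastforce simp: o_def)
  have inP: "(s, k (g s, v)) \<in> over ?P N" if "s \<in> N" "v \<in> topspace (Euclidean_space n)" for s v
  proof -
    have "g s \<in> U" using that gN by blast
    then show ?thesis
      using \<phi>k[of "g s" v] fst\<phi>[of "k (g s, v)"] that overN by (auto simp: over_def)
  qed
  have "continuous_map ?Z (prod_topology T (total E)) (\<lambda>y. (fst y, k (g (fst y), snd y)))"
    using cZ ck by (simp add: continuous_map_pairwise o_def)
  then have "continuous_map ?Z (total ?P) (\<lambda>y. (fst y, k (g (fst y), snd y)))"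
    unfolding pullback_bundle_def bundle_data.simps
    by (rule continuous_map_into_subtopology) (use inP overN NT in fastforce)
  then have c2: "continuous_map ?Z ?Y (\<lambda>y. (fst y, k (g (fst y), snd y)))"
    by (rule continuous_map_into_subtopology) (use inP in auto)
  have "homeomorphic_maps ?Y ?Z (\<lambda>(s, e). (s, snd (\<phi> e))) (\<lambda>y. (fst y, k (g (fst y), snd y)))"
    unfolding homeomorphic_maps_def
  proof (intro conjI ballI c1 c2)
    fix y assume y: "y \<in> topspace ?Y"
    have "\<phi> (snd y) = (g (fst y), snd (\<phi> (snd y)))"
      using fst\<phi>[OF sndU] y tY overN by (auto simp: prod_eq_iff)
    then show "(\<lambda>y. (fst y, k (g (fst y), snd y))) ((\<lambda>(s, e). (s, snd (\<phi> e))) y) = y"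
      using k\<phi>[OF sndU, of y] y tY by (auto simp: split_beta)
  next
    fix y assume "y \<in> topspace ?Z"
    then show "(\<lambda>(s, e). (s, snd (\<phi> e))) (fst y, k (g (fst y), snd y)) = y"
      using gN \<phi>k(1) by auto
  qed
  then have hom: "homeomorphic_map ?Y (prod_topology (subtopology (base ?P) N) (Euclidean_space n))
      (\<lambda>(s, e). (s, snd (\<phi> e)))"
    using homeomorphic_map_maps by (auto simp: pullback_bundle_def)
  have fib: "fst v = s \<and> snd v \<in> fibre E (g s)" if "v \<in> fibre ?P s" for v s
    using that by (auto simp: over_def pullback_bundle_def)
  show ?thesis
    unfolding local_trivialization_def
  proof (intro conjI ballI allI hom)
    show "openin (base ?P) N" using N by (simp add: pullback_bundle_def)
    show "fst ((\<lambda>(s, e). (s, snd (\<phi> e))) e) = proj ?P e" for e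
      by (simp add: pullback_bundle_def split_beta)
  next
    fix s v w assume s: "s \<in> N" and vw: "v \<in> fibre ?P s" "w \<in> fibre ?P s"
    have "g s \<in> U" using s gN by blast
    then have "snd (\<phi> (fadd E (snd v) (snd w))) = (\<lambda>i. snd (\<phi> (snd v)) i + snd (\<phi> (snd w)) i)"
      using \<phi> fib[OF vw(1)] fib[OF vw(2)] unfolding local_trivialization_def by blast
    then show "snd ((\<lambda>(s, e). (s, snd (\<phi> e))) (fadd ?P v w)) =
        (\<lambda>i. snd ((\<lambda>(s, e). (s, snd (\<phi> e))) v) i + snd ((\<lambda>(s, e). (s, snd (\<phi> e))) w) i)"
      by (simp add: pullback_bundle_def split_beta)
  next
    fix s r v assume s: "s \<in> N" and v: "v \<in> fibre ?P s"
    have "g s \<in> U" using s gN by blast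
    then have "snd (\<phi> (fscale E r (snd v))) = (\<lambda>i. r * snd (\<phi> (snd v)) i)"
      using \<phi> fib[OF v] unfolding local_trivialization_def by blast
    then show "snd ((\<lambda>(s, e). (s, snd (\<phi> e))) (fscale ?P r v)) =
        (\<lambda>i. r * snd ((\<lambda>(s, e). (s, snd (\<phi> e))) v) i)"
      by (simp add: pullback_bundle_def split_beta)
  qed
qed

text \<open>The inverse of the pulled-back trivialization over \<open>s\<close> is that of \<phi>
  over \<open>g s\<close> paired with \<open>s\<close>, so the two matrices have the same
  entries.\<close>

lemma transition_matrix_pullback:
  assumes \<phi>: "local_trivialization n E U \<phi>" and g: "continuous_map T (base E) g"
    and N: "openin T N" and gN: "g ` N \<subseteq> U" and s: "s \<in> N"
  shows "transition_matrix n (pullback_bundle T g E)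
      (\<lambda>(s, e). (s, snd (\<phi> e))) (\<lambda>(s, e). (s, snd (\<psi> e))) s = transition_matrix n E \<phi> \<psi> (g s)"
    (is "transition_matrix n ?P ?\<phi> ?\<psi> s = _")
proof -
  have gs: "g s \<in> U" using gN s by blast
  have "fibre_inv ?P ?\<phi> s v = (s, fibre_inv E \<phi> (g s) v)"
    if v: "v \<in> topspace (Euclidean_space n)" for v
  proof -
    note e = fibre_inv(1,2)[OF \<phi> gs v]
    have "(s, fibre_inv E \<phi> (g s) v) \<in> fibre ?P s"
      using e(1) openin_subset[OF N] s by (auto simp: over_def pullback_bundle_def)
    from fibre_inv(4)[OF local_trivialization_pullback[OF \<phi> g N gN] s this]
    show ?thesis using e(2) by simp
  qed
  then show ?thesis
    by (intro eq_matI) (auto simp: transition_matrix_def topspace_Euclidean_space)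
qed

text \<open>The atlas has one chart for each point \<open>x\<close> of \<open>S\<close>: the
  pullback of \<open>\<sigma> x\<close>, restricted to a neighbourhood of \<open>x\<close> on which
  it is positively related to every \<open>\<sigma> y\<close>.\<close>

lemma orientable_pullback_bundle:
  assumes E: "real_vector_bundle n E" and g: "continuous_map (top_of_set S) (base E) g"
    and \<sigma>: "orients_along n E g S \<sigma>"
  shows "orientable_bundle n (pullback_bundle (top_of_set S) g E)"
proof -
  let ?P = "pullback_bundle (top_of_set S) g E"
  have "\<exists>N. open N \<and> x \<in> N \<and> (\<forall>y\<in>N \<inter> S. g y \<in> fst (\<sigma> x) \<and>
      0 < transition_det n E (snd (\<sigma> x)) (snd (\<sigma> y)) (g y))" if "x \<in> S" for x
    using orients_alongD(3)[OF \<sigma> that] unfolding eventually_nhds by blast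
  then obtain N where *: "\<forall>x\<in>S. open (N x) \<and> x \<in> N x \<and> (\<forall>y\<in>N x \<inter> S. g y \<in> fst (\<sigma> x) \<and>
      0 < transition_det n E (snd (\<sigma> x)) (snd (\<sigma> y)) (g y))"
    by metis
  then have N: "\<And>x. x \<in> S \<Longrightarrow> open (N x)" "\<And>x. x \<in> S \<Longrightarrow> x \<in> N x"
    and pos: "\<And>x y. x \<in> S \<Longrightarrow> y \<in> N x \<Longrightarrow> y \<in> S \<Longrightarrow> g y \<in> fst (\<sigma> x)"
      "\<And>x y. x \<in> S \<Longrightarrow> y \<in> N x \<Longrightarrow> y \<in> S \<Longrightarrow>
        0 < transition_det n E (snd (\<sigma> x)) (snd (\<sigma> y)) (g y)"
    by blast+
  have op: "openin (top_of_set S) (S \<inter> N x)" if "x \<in> S" for x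
    using N(1)[OF that] by (rule openin_open_Int)
  have sub: "g ` (S \<inter> N x) \<subseteq> fst (\<sigma> x)" if "x \<in> S" for x
    using pos(1) that by blast
  let ?\<A> = "(\<lambda>x. (S \<inter> N x, \<lambda>(s, e). (s, snd (snd (\<sigma> x) e)))) ` S"
  have "local_trivialization n ?P (S \<inter> N x) (\<lambda>(s, e). (s, snd (snd (\<sigma> x) e)))"
    if x: "x \<in> S" for x
    by (rule local_trivialization_pullback[OF orients_alongD(1)[OF \<sigma> x] g op[OF x] sub[OF x]])
  moreover have "(\<Union>(U, \<phi>)\<in>?\<A>. U) = topspace (base ?P)"
    using N(2) by (auto simp: pullback_bundle_def)
  moreover have "0 < transition_det n ?P (\<lambda>(s, e). (s, snd (snd (\<sigma> x) e)))
      (\<lambda>(s, e). (s, snd (snd (\<sigma> y) e))) s"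
    if x: "x \<in> S" and y: "y \<in> S" and s: "s \<in> S \<inter> N x" "s \<in> S \<inter> N y" for x y s
  proof -
    have sS: "s \<in> S" "s \<in> N x" "s \<in> N y" using s by auto
    note \<sigma>x = orients_alongD(1)[OF \<sigma> x] and \<sigma>y = orients_alongD(1)[OF \<sigma> y]
      and \<sigma>s = orients_alongD(1,2)[OF \<sigma> sS(1)]
    note gx = pos(1)[OF x sS(2,1)] and gy = pos(1)[OF y sS(3,1)]
    \<comment> \<open>Two charts need not be related at their centres; at a common point
      \<open>s\<close> both are positively related to \<open>\<sigma> s\<close>, and hence to each
      other.\<close>
    have "0 < transition_det n E (snd (\<sigma> x)) (snd (\<sigma> y)) (g s)"
      using transition_det_pos_trans[OF E \<sigma>x \<sigma>s(1) \<sigma>y gx \<sigma>s(2) gy]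
        transition_det_pos_sym[OF E \<sigma>s(1) \<sigma>y \<sigma>s(2) gy] pos(2)[OF x sS(2,1)] pos(2)[OF y sS(3,1)]
      by simp
    then show ?thesis
      using transition_matrix_pullback[OF \<sigma>x g op[OF x] sub[OF x] s(1)] by metis
  qed
  ultimately show ?thesis
    unfolding orientable_bundle_def by (intro exI[of _ ?\<A>]) auto
qed

section \<open>Extending a loop in a simply connected space\<close>

text \<open>A homotopy from the loop to a constant is run along the radii. The extension is made to
  the whole plane, not only to the disc, so that it is a continuous map on \<open>euclidean\<close>,
  as the orientation lemmas require.\<close>

lemma simply_connected_circle_extends_to_plane:
  fixes \<gamma> :: "complex \<Rightarrow> 'a::topological_space"
  assumes X: "simply_connected X" and \<gamma>: "continuous_on (sphere 0 1) \<gamma>" "\<gamma> \<in> sphere 0 1 \<rightarrow> X"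
  obtains h :: "complex \<Rightarrow> 'a" where "continuous_on UNIV h" "range h \<subseteq> X"
    "\<And>z. z \<in> sphere 0 1 \<Longrightarrow> h z = \<gamma> z"
proof -
  define c where "c = \<gamma> 1"
  have cX: "c \<in> X" using \<gamma>(2) by (auto simp: c_def)
  have "homotopic_with_canon (\<lambda>h. True) (sphere 0 1) X \<gamma> (\<lambda>_. c)"
    by (rule simply_connected_eq_homotopic_circlemaps1[OF X \<gamma>]) (use cX in auto)
  then obtain H where H: "continuous_on ({0..1} \<times> sphere 0 1) H"
      "H \<in> {0..1::real} \<times> sphere 0 1 \<rightarrow> X"
      "\<And>z. H (0, z) = \<gamma> z" "\<And>z. H (1, z) = c"
    unfolding homotopic_with_def by (auto simp: continuous_map_subtopology_eu)
  \<comment> \<open>The time parameter falls from 1 at modulus 1/2 to 0 at modulus 1 and is held at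
    0 beyond, so \<open>h\<close> starts from \<open>c\<close>, reaches \<gamma> on the circle and
    is constant along rays outside it. The inner disc, where \<open>h\<close> is \<open>c\<close>,
    avoids the origin, at which \<open>sgn\<close> is discontinuous.\<close>
  define r where "r z = (max 0 (2 - 2 * cmod z), sgn z)" for z
  define h where "h z = (if cmod z \<le> 1/2 then c else H (r z))" for z
  have r: "r z \<in> {0..1} \<times> sphere 0 1" if "cmod z \<ge> 1/2" for z
    using that by (auto simp: r_def norm_sgn)
  show ?thesis
  proof
    have cr: "continuous_on {z. cmod z \<ge> 1/2} r"
      unfolding r_def sgn_div_norm by (intro continuous_intros) auto
    have "continuous_on {z. cmod z \<ge> 1/2} (\<lambda>z. H (r z))"
      by (rule continuous_on_compose2[OF H(1) cr]) (use r in blast)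
    moreover have "H (r z) = c" if "cmod z = 1/2" for z
      by (simp add: r_def that H(4))
    ultimately have "continuous_on ({z. cmod z \<le> 1/2} \<union> {z. cmod z \<ge> 1/2}) h"
      unfolding h_def
      by (intro continuous_on_cases closed_Collect_le continuous_intros) auto
    moreover have "{z. cmod z \<le> 1/2} \<union> {z. cmod z \<ge> 1/2} = UNIV" by auto
    ultimately show "continuous_on UNIV h" by simp
    show "range h \<subseteq> X"
      using cX H(2) r by (fastforce simp: h_def Pi_iff)
    show "h z = \<gamma> z" if "z \<in> sphere 0 1" for z
      using that by (simp add: h_def r_def H(3) sgn_div_norm)
  qed
qed

section \<open>Non-orientability forces a point outside \<open>A\<close>\<close>

theorem lemma5p1p1:
  fixes X A :: "'a::topological_space set"
    and \<gamma> :: "complex \<Rightarrow> 'a"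
    and E :: "('a, 'e) bundle_data"
    and n :: nat
  assumes "simply_connected X"
    and "A \<subseteq> X"
    and "continuous_map (top_of_set (sphere 0 1)) (top_of_set A) \<gamma>"
    and "real_vector_bundle n E"
    and "base E = top_of_set A"
    and "\<not> orientable_bundle n (pullback_bundle (top_of_set (sphere 0 1)) \<gamma> E)"
  shows "X - A \<noteq> {}"
proof
  assume "X - A = {}"
  then have "A = X" using assms(2) by blast
  have "continuous_on (sphere 0 1) \<gamma>" "\<gamma> \<in> sphere 0 1 \<rightarrow> X"
    using assms(3) \<open>A = X\<close> by (auto simp: continuous_map_in_subtopology continuous_map_subtopology_eu)
  then obtain h where h: "continuous_on UNIV h" "range h \<subseteq> X"
    and h\<gamma>: "\<And>z. z \<in> sphere 0 1 \<Longrightarrow> h z = \<gamma> z"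
    using simply_connected_circle_extends_to_plane[OF assms(1)] by metis
  \<comment> \<open>The extension takes values in \<open>X\<close>; because \<open>A = X\<close>,
    these lie in the base of \<open>E\<close>, so \<open>E\<close> can be oriented along
    \<open>h\<close>.\<close>
  have "continuous_map euclidean (base E) h"
    using h \<open>A = X\<close> assms(5) by (auto simp: continuous_map_in_subtopology)
  from orients_along_cbox[OF assms(4) this, of "-1" 1 "-1" 1]
  obtain \<sigma> where "orients_along n E h (cbox (Complex (-1) (-1)) (Complex 1 1)) \<sigma>" by auto
  then have "orients_along n E h (sphere 0 1) \<sigma>"
  proof (rule orients_along_subset)
    show "sphere 0 1 \<subseteq> cbox (Complex (-1) (-1)) (Complex 1 1)"
    proof
      fix z :: complex assume "z \<in> sphere 0 1"
      then show "z \<in> cbox (Complex (-1) (-1)) (Complex 1 1)"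
        using abs_Re_le_cmod[of z] abs_Im_le_cmod[of z] by (auto simp: in_cbox_complex_iff)
    qed
  qed
  \<comment> \<open>The condition over the circle involves \<open>h\<close> only at points of the
    circle, where it equals \<gamma>.\<close>
  then have "orients_along n E \<gamma> (sphere 0 1) \<sigma>"
    using h\<gamma> unfolding orients_along_def by (fastforce elim: eventually_mono)
  then show False
    using orientable_pullback_bundle[OF assms(4)] assms(3,5,6) by metis
qed

end
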